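(* There are $N$ coins, one of which is fake, and it is not known whether it is heavier or lighter than the genuine coins. There are also $k$ balance scales that can be used in parallel, one weighing per minute. The maximum number of coins that requires $n$ minutes to find and label the fake coin is $$\frac{(2k+1)^n+1}{2}-k-1.$$ If $N=2$, then the problem cannot be resolved.
   Context: All genuine coins have the same weight; exactly one coin is fake, and it is either lighter or heavier than a genuine coin. To find and label the fake coin means to identify it and to determine whether it is heavier or lighter than a genuine coin. A number of coins requires $n$ minutes if $n$ is the minimum number of minutes that guarantees accomplishing this task. There are $k$ two-pan balance scales usable simultaneously. In each minute each scale may be used for one weighing; in a given minute each coin is placed on at most one pan of at most one scale, and each weighing puts the same number of coins on its two pans. Each weighing reports that the pans balance, or which pan is lighter. Strategies may be adaptive: the weighings in a minute may depend on all results from earlier minutes. Only the $N$ given coins are available; no additional coins known to be genuine are provided. *)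

theory Defs
  imports Complex_Main
begin

text \<open>Coins are the numbers below \<open>N\<close>, scales the numbers below \<open>k\<close>.\<close>

datatype side = Left_Pan | Right_Pan

datatype outcome = Balanced | Left_Lighter | Right_Lighter

datatype label = Heavier | Lighter

text \<open>Since a placement is a function of the coin, each coin is on at most one pan of at most one
  scale. An idle scale is one with two empty pans.\<close>

type_synonym placement = "nat \<Rightarrow> (nat \<times> side) option"

definition pan :: "nat \<Rightarrow> placement \<Rightarrow> nat \<Rightarrow> side \<Rightarrow> nat set" where
  "pan N p s d = {c. c < N \<and> p c = Some (s, d)}"

definition valid_placement :: "nat \<Rightarrow> nat \<Rightarrow> placement \<Rightarrow> bool" where
  "valid_placement k N p \<longleftrightarrow>
     (\<forall>c<N. \<forall>s d. p c = Some (s, d) \<longrightarrow> s < k) \<and>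
     (\<forall>s<k. card (pan N p s Left_Pan) = card (pan N p s Right_Pan))"

text \<open>Coin \<open>f\<close> is the fake one; it weighs \<open>v\<close> and every other coin weighs \<open>g\<close>.\<close>

definition coin_weight :: "nat \<Rightarrow> real \<Rightarrow> real \<Rightarrow> nat \<Rightarrow> real" where
  "coin_weight f v g c = (if c = f then v else g)"

text \<open>The outcomes of all scales in one minute, indexed by the scale. For a valid placement, indices
  \<open>s \<ge> k\<close> always yield \<^const>\<open>Balanced\<close> and so carry no information.\<close>

definition minute_result :: "nat \<Rightarrow> (nat \<Rightarrow> real) \<Rightarrow> placement \<Rightarrow> nat \<Rightarrow> outcome" where
  "minute_result N w p s =
     (let l = (\<Sum>c\<in>pan N p s Left_Pan. w c); r = (\<Sum>c\<in>pan N p s Right_Pan. w c)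
      in if l < r then Left_Lighter else if r < l then Right_Lighter else Balanced)"

text \<open>An adaptive strategy chooses the next placement from the results of all earlier minutes
  (oldest first).\<close>

type_synonym strategy = "(nat \<Rightarrow> outcome) list \<Rightarrow> placement"

primrec run :: "nat \<Rightarrow> (nat \<Rightarrow> real) \<Rightarrow> strategy \<Rightarrow> nat \<Rightarrow> (nat \<Rightarrow> outcome) list" where
  "run N w \<sigma> 0 = []"
| "run N w \<sigma> (Suc t) = run N w \<sigma> t @ [minute_result N w (\<sigma> (run N w \<sigma> t))]"

text \<open>Because scales may stay idle, this expresses that at most \<open>n\<close> minutes suffice. The verdict
  sees only the recorded results; the weights \<open>v\<close> and \<open>g\<close> are unknown.\<close>

definition solvable_in :: "nat \<Rightarrow> nat \<Rightarrow> nat \<Rightarrow> bool" where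
  "solvable_in k N n \<longleftrightarrow>
     (\<exists>(\<sigma> :: strategy) (verdict :: (nat \<Rightarrow> outcome) list \<Rightarrow> nat \<times> label).
        (\<forall>h. valid_placement k N (\<sigma> h)) \<and>
        (\<forall>f v g. f < N \<and> 0 < v \<and> 0 < g \<and> v \<noteq> g \<longrightarrow>
           verdict (run N (coin_weight f v g) \<sigma> n) = (f, if v > g then Heavier else Lighter)))"

definition requires_minutes :: "nat \<Rightarrow> nat \<Rightarrow> nat \<Rightarrow> bool" where
  "requires_minutes k N n \<longleftrightarrow> solvable_in k N n \<and> (\<forall>m<n. \<not> solvable_in k N m)"

text \<open>Zero coins are excluded, since one of the coins is fake.\<close>

definition coin_numbers :: "nat \<Rightarrow> nat \<Rightarrow> nat set" where
  "coin_numbers k n = {N. 1 \<le> N \<and> requires_minutes k N n}"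

end

theory Submission
  imports Defs "HOL-Number_Theory.Cong"
begin

text \<open>Write \<open>b = 2 * k + 1\<close>. Since only one coin is fake, at most one scale tips in a minute, so a
  minute has only \<open>b\<close> possible results: everything balances, or one of the \<open>k\<close> scales tips in one of
  two directions. With \<open>N\<close> coins there are \<open>2 * N\<close> hypotheses (which coin, heavier or lighter), and
  a strategy succeeds in \<open>n\<close> minutes exactly when different hypotheses produce different sequences
  of \<open>n\<close> results (\<open>solvable_in_iff_inj_trace\<close>). The theorem is thus about codes of length \<open>n\<close> over
  an alphabet of \<open>b\<close> symbols.

  Upper bound (\<open>solvable_in_imp_bound\<close>): the hypotheses compatible with a given first result are even
  in number, because the two pans of a scale hold equally many coins and because a coin left aside is
  compatible with both labels. The remaining \<open>n - 1\<close> minutes distinguish at most \<open>b ^ (n - 1)\<close>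
  hypotheses, which is odd, so each of the \<open>b\<close> first results wastes at least one code word. Hence
  \<open>2 * N \<le> b ^ n - b\<close>, and this is twice the claimed maximum.

  Attaining it (\<open>solvable_in_cyclic_scheme\<close>): as in Dyson's solution for one scale, all weighings can
  be fixed in advance. Give every coin a word over the integers modulo \<open>b\<close>, one letter per minute.
  Letter 0 means that the coin is left aside, and the letters \<open>x\<close> and \<open>- x\<close> denote the two pans of
  one scale. The sequence of results then reveals the word of the fake coin if that coin is lighter,
  and the negated word if it is heavier. So the words of two coins must neither coincide nor be
  negatives of each other, no word may be its own negative, and in each minute the letters \<open>x\<close> and
  \<open>- x\<close> must occur equally often. Adding one constant to all letters permutes the non-constant words
  in orbits of size \<open>b\<close>, and within an orbit every letter occurs exactly once at each position.
  Negation maps orbits to orbits and, \<open>b\<close> being odd, fixes none of the non-constant ones. Choosing one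
  orbit out of each pair of opposite ones gives all \<open>(b ^ n - b) / 2\<close> words that are needed. Balanced
  base-\<open>b\<close> digits make the choice explicit: an orbit corresponds to a nonzero integer in a symmetric
  interval, negation to changing its sign, and the positive integers are chosen.

  Two coins are hopeless because a heavy coin beside a normal one looks the same as a normal coin
  beside a light one (\<open>not_solvable_in_two\<close>).\<close>

section \<open>What a minute reveals\<close>

fun opposite :: "side \<Rightarrow> side" where
  "opposite Left_Pan = Right_Pan"
| "opposite Right_Pan = Left_Pan"

fun tilt :: "side \<Rightarrow> label \<Rightarrow> outcome" where
  "tilt Left_Pan Lighter = Left_Lighter"
| "tilt Left_Pan Heavier = Right_Lighter"
| "tilt Right_Pan Lighter = Right_Lighter"
| "tilt Right_Pan Heavier = Left_Lighter"

text \<open>The argument \<open>q\<close> is the position of the fake coin and \<open>l\<close> its label: nothing else about the weighing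
  influences its result.\<close>

definition response :: "(nat \<times> side) option \<Rightarrow> label \<Rightarrow> nat \<Rightarrow> outcome" where
  "response q l = (case q of None \<Rightarrow> (\<lambda>_. Balanced) | Some (s, d) \<Rightarrow> (\<lambda>_. Balanced)(s := tilt d l))"

lemma tilt_opposite: "tilt (opposite d) Lighter = tilt d Heavier"
  by (cases d) auto

lemma tilt_neq_Balanced [simp]: "tilt d l \<noteq> Balanced" "Balanced \<noteq> tilt d l"
  by (cases d; cases l; simp)+

lemma tilt_Lighter_inj: "tilt d Lighter = tilt d' Lighter \<Longrightarrow> d = d'"
  by (cases d; cases d') auto

text \<open>A heavy coin looks like a light coin on the opposite pan. This is what turns the label into a sign.\<close>

lemma response_Heavier: "response q Heavier = response (map_option (apsnd opposite) q) Lighter"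
  by (auto simp: response_def tilt_opposite split: option.splits)

lemma response_Lighter_inj:
  assumes "response q Lighter = response q' Lighter"
  shows "q = q'"
proof (cases q)
  case None
  show ?thesis
  proof (cases q')
    case (Some z)
    then show ?thesis using None fun_cong[OF assms, of "fst z"]
      by (auto simp: response_def split: prod.splits)
  qed (use None in simp)
next
  case (Some y)
  show ?thesis using Some fun_cong[OF assms, of "fst y"]
    by (cases q') (auto simp: response_def split: prod.splits if_splits dest: tilt_Lighter_inj)
qed

lemma finite_pan [simp]: "finite (pan N p s d)"
  by (simp add: pan_def)

lemma pan_weight:
  "(\<Sum>c\<in>pan N p s d. coin_weight f v g c)
     = real (card (pan N p s d)) * g + (if f \<in> pan N p s d then v - g else 0)"
proof -
  have "coin_weight f v g c = g + (if c = f then v - g else 0)" for c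
    by (simp add: coin_weight_def)
  then show ?thesis
    by (simp add: sum.distrib sum.delta)
qed

text \<open>With equally many coins on both pans the common weight \<open>g\<close> cancels, and only the excess \<open>v - g\<close>
  of the fake coin is left to tip its scale.\<close>

lemma minute_result_eq_response:
  assumes p: "valid_placement k N p" and f: "f < N" and "v \<noteq> g"
  shows "minute_result N (coin_weight f v g) p
           = response (p f) (if v > g then Heavier else Lighter)"
proof
  fix s
  have eq: "card (pan N p s Left_Pan) = card (pan N p s Right_Pan)"
  proof (cases "s < k")
    case True
    then show ?thesis using p by (simp add: valid_placement_def)
  next
    case False
    then have "pan N p s d = {}" for d
      using p by (auto simp: valid_placement_def pan_def)
    then show ?thesis by simp
  qed
  have mem: "f \<in> pan N p s d \<longleftrightarrow> p f = Some (s, d)" for d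
    using f by (simp add: pan_def)
  show "minute_result N (coin_weight f v g) p s
          = response (p f) (if v > g then Heavier else Lighter) s"
  proof (cases "p f")
    case None
    then show ?thesis
      by (simp add: minute_result_def Let_def pan_weight mem eq response_def)
  next
    case (Some z)
    obtain s' d where z: "z = (s', d)" by (cases z)
    show ?thesis using \<open>v \<noteq> g\<close>
      by (cases d) (auto simp: minute_result_def Let_def pan_weight mem eq response_def Some z)
  qed
qed

section \<open>Solvability as injectivity\<close>

text \<open>The weights enter a run only through the label of the fake coin
  (\<open>minute_result_eq_response\<close>), so that a run is determined by the hypothesis alone.\<close>

primrec trace :: "strategy \<Rightarrow> nat \<Rightarrow> nat \<times> label \<Rightarrow> (nat \<Rightarrow> outcome) list" where
  "trace \<sigma> 0 h = []"
| "trace \<sigma> (Suc t) h = trace \<sigma> t h @ [response (\<sigma> (trace \<sigma> t h) (fst h)) (snd h)]"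

abbreviation hypotheses :: "nat \<Rightarrow> (nat \<times> label) set" where
  "hypotheses N \<equiv> {..<N} \<times> UNIV"

lemma UNIV_label: "(UNIV :: label set) = {Heavier, Lighter}"
  using label.exhaust by auto

lemma UNIV_side: "(UNIV :: side set) = {Left_Pan, Right_Pan}"
  using side.exhaust by auto

lemma finite_hypotheses: "finite (hypotheses N)"
  by (simp add: UNIV_label)

lemma card_hypotheses: "card (hypotheses N) = 2 * N"
  by (simp add: card_cartesian_product UNIV_label)

lemma run_eq_trace:
  assumes "\<forall>h. valid_placement k N (\<sigma> h)" "f < N" "v \<noteq> g"
  shows "run N (coin_weight f v g) \<sigma> n = trace \<sigma> n (f, if v > g then Heavier else Lighter)"
  using assms by (induction n) (simp_all add: minute_result_eq_response[where k = k] del: if_split)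

text \<open>A verdict is a left inverse of the map from hypotheses to recorded results.\<close>

lemma solvable_in_iff_inj_trace:
  "solvable_in k N n \<longleftrightarrow>
     (\<exists>\<sigma>. (\<forall>h. valid_placement k N (\<sigma> h)) \<and> inj_on (trace \<sigma> n) (hypotheses N))"
proof
  assume "solvable_in k N n"
  then obtain \<sigma> verdict where val: "\<forall>h. valid_placement k N (\<sigma> h)"
    and ver: "\<And>f v g. f < N \<Longrightarrow> 0 < v \<Longrightarrow> 0 < g \<Longrightarrow> v \<noteq> g \<Longrightarrow>
      verdict (run N (coin_weight f v g) \<sigma> n) = (f, if v > g then Heavier else Lighter)"
    unfolding solvable_in_def by blast
  have "verdict (trace \<sigma> n (f, l)) = (f, l)" if "f < N" for f l
    using ver[OF that, of 2 1] ver[OF that, of 1 2] run_eq_trace[OF val that, of 2 1 n]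
      run_eq_trace[OF val that, of 1 2 n]
    by (cases l) simp_all
  then have "inj_on (trace \<sigma> n) (hypotheses N)"
    by (intro inj_on_inverseI[of _ verdict]) auto
  with val show "\<exists>\<sigma>. (\<forall>h. valid_placement k N (\<sigma> h)) \<and> inj_on (trace \<sigma> n) (hypotheses N)"
    by blast
next
  assume "\<exists>\<sigma>. (\<forall>h. valid_placement k N (\<sigma> h)) \<and> inj_on (trace \<sigma> n) (hypotheses N)"
  then obtain \<sigma> where val: "\<forall>h. valid_placement k N (\<sigma> h)"
    and inj: "inj_on (trace \<sigma> n) (hypotheses N)" by blast
  have "inv_into (hypotheses N) (trace \<sigma> n) (run N (coin_weight f v g) \<sigma> n)
          = (f, if v > g then Heavier else Lighter)" if "f < N" "v \<noteq> g" for f v g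
    unfolding run_eq_trace[OF val that] using inj that by (intro inv_into_f_f) auto
  with val show "solvable_in k N n"
    unfolding solvable_in_def by blast
qed

section \<open>The upper bound\<close>

text \<open>The label \<open>Lighter\<close> suffices by \<open>response_Heavier\<close>: each tipping result is that of a light coin on
  the pan that rises.\<close>

definition responses :: "nat \<Rightarrow> (nat \<Rightarrow> outcome) set" where
  "responses k = insert (response None Lighter)
     ((\<lambda>z. response (Some z) Lighter) ` ({..<k} \<times> UNIV))"

lemma finite_responses: "finite (responses k)"
  by (simp add: responses_def UNIV_side)

lemma card_responses_le: "card (responses k) \<le> 2 * k + 1"
proof -
  have "card ((\<lambda>z. response (Some z) Lighter) ` ({..<k} \<times> UNIV)) \<le> card ({..<k} \<times> (UNIV :: side set))"
    by (intro card_image_le) (simp add: UNIV_side)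
  also have "\<dots> = 2 * k" by (simp add: card_cartesian_product UNIV_side)
  finally show ?thesis
    unfolding responses_def by (simp add: UNIV_side card_insert_if)
qed

lemma response_in_responses:
  assumes "valid_placement k N p" "f < N"
  shows "response (p f) l \<in> responses k"
proof (cases "p f")
  case None
  then show ?thesis by (cases l) (simp_all add: responses_def response_def)
next
  case (Some z)
  then have "fst z < k" using assms by (cases z) (auto simp: valid_placement_def)
  then show ?thesis using Some
    by (cases l; cases z) (auto simp: responses_def response_Heavier)
qed

lemma trace_in_responses:
  assumes "\<forall>h. valid_placement k N (\<sigma> h)" "h \<in> hypotheses N"
  shows "set (trace \<sigma> n h) \<subseteq> responses k" "length (trace \<sigma> n h) = n"
  using assms response_in_responses by (induction n) (auto, blast)

lemma hd_trace: "hd (trace \<sigma> (Suc n) h) = response (\<sigma> [] (fst h)) (snd h)"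
  by (induction n) (auto simp: hd_append)

text \<open>If everything balances, the fake coin was left aside and both labels remain possible. If one scale
  tips, the suspects are the coins of the rising pan as light ones and the equally many coins of the
  sinking pan as heavy ones.\<close>

lemma even_card_response_class:
  assumes p: "valid_placement k N p" and r: "r \<in> responses k"
  shows "even (card {h \<in> hypotheses N. response (p (fst h)) (snd h) = r})"
  using r unfolding responses_def
proof (elim insertE imageE)
  assume r: "r = response None Lighter"
  have "{h \<in> hypotheses N. response (p (fst h)) (snd h) = r} = {f. f < N \<and> p f = None} \<times> UNIV"
  proof -
    have "response q l = response None Lighter \<longleftrightarrow> q = None" for q l
      by (cases l) (auto simp: response_Heavier dest: response_Lighter_inj)
    then show ?thesis unfolding r by auto
  qed
  then show ?thesis by (simp add: card_cartesian_product UNIV_label)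
next
  fix z assume r: "r = response (Some z) Lighter" and z: "z \<in> {..<k} \<times> (UNIV :: side set)"
  obtain s d where sd: "z = (s, d)" by (cases z)
  have inv: "opposite (opposite e) = e" for e by (cases e) auto
  have H: "response q Heavier = response (Some (s, d)) Lighter \<longleftrightarrow> q = Some (s, opposite d)" for q
    by (auto simp: response_Heavier inv dest!: response_Lighter_inj)
  have L: "response q Lighter = response (Some (s, d)) Lighter \<longleftrightarrow> q = Some (s, d)" for q
    by (auto dest!: response_Lighter_inj)
  have "{h \<in> hypotheses N. response (p (fst h)) (snd h) = r}
      = pan N p s d \<times> {Lighter} \<union> pan N p s (opposite d) \<times> {Heavier}" (is "?C = _")
  proof (rule set_eqI)
    fix h show "h \<in> ?C \<longleftrightarrow> h \<in> pan N p s d \<times> {Lighter} \<union> pan N p s (opposite d) \<times> {Heavier}"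
      by (cases h; cases "snd h") (auto simp: r sd H L pan_def)
  qed
  then have "card ?C = card (pan N p s d) + card (pan N p s (opposite d))"
    by (simp add: card_Un_disjoint card_cartesian_product disjoint_iff)
  moreover have "card (pan N p s d) = card (pan N p s (opposite d))"
    using p z sd by (cases d) (auto simp: valid_placement_def)
  ultimately show ?thesis by simp
qed

text \<open>The hypotheses are split by the result of the first minute. Each part is even in number and injects
  into the sequences of the remaining results, whose number is at most the odd \<open>(2 * k + 1) ^ (n - 1)\<close>.\<close>

lemma solvable_in_imp_bound:
  assumes "solvable_in k N n" "N \<ge> 1"
  shows "2 * N + (2 * k + 1) \<le> (2 * k + 1) ^ n"
proof -
  let ?b = "2 * k + 1"
  obtain \<sigma> where val: "\<forall>h. valid_placement k N (\<sigma> h)"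
    and inj: "inj_on (trace \<sigma> n) (hypotheses N)"
    using assms(1) unfolding solvable_in_iff_inj_trace by blast
  show ?thesis
  proof (cases n)
    case 0
    \<comment> \<open>Without a weighing, coin 0 cannot be labelled.\<close>
    have "(0, Heavier) = (0 :: nat, Lighter)"
      using inj assms(2) 0 by (intro inj_onD[OF inj]) auto
    then show ?thesis by simp
  next
    case (Suc m)
    define cls where "cls r = {h \<in> hypotheses N. response (\<sigma> [] (fst h)) (snd h) = r}" for r
    have fin: "finite (cls r)" for r
      unfolding cls_def using finite_hypotheses by simp
    have bound: "card (cls r) + 1 \<le> ?b ^ m" if r: "r \<in> responses k" for r
    proof -
      let ?L = "{xs. set xs \<subseteq> responses k \<and> length xs = m}"
      have "trace \<sigma> n h \<in> Cons r ` ?L" if h: "h \<in> cls r" for h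
      proof (cases "trace \<sigma> n h")
        case Nil
        then show ?thesis using Suc by simp
      next
        case (Cons x xs)
        then have "x = r" using hd_trace[of \<sigma> m h] h Suc by (simp add: cls_def)
        then show ?thesis
          using Cons trace_in_responses[OF val, of h n] h Suc by (auto simp: cls_def)
      qed
      then have "card (cls r) \<le> card (Cons r ` ?L)"
        using inj by (intro card_inj_on_le[of "trace \<sigma> n"])
          (auto simp: cls_def finite_lists_length_eq[OF finite_responses] intro: inj_on_subset)
      also have "\<dots> \<le> card ?L"
        by (intro card_image_le finite_lists_length_eq finite_responses)
      also have "\<dots> \<le> ?b ^ m"
        unfolding card_lists_length_eq[OF finite_responses]
        by (intro power_mono card_responses_le) simp
      finally have "card (cls r) \<le> ?b ^ m" .
      \<comment> \<open>An even number bounded by an odd one misses it by at least one.\<close>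
      moreover have "even (card (cls r))"
        unfolding cls_def using even_card_response_class val r by blast
      ultimately show ?thesis
        by (cases "card (cls r) = ?b ^ m") simp_all
    qed
    have "hypotheses N = (\<Union>r\<in>responses k. cls r)"
      unfolding cls_def using response_in_responses val by fastforce
    then have "2 * N = card (\<Union>r\<in>responses k. cls r)"
      using card_hypotheses by metis
    also have "\<dots> \<le> (\<Sum>r\<in>responses k. card (cls r))"
      by (intro card_UN_le finite_responses)
    also have "\<dots> \<le> (\<Sum>r\<in>responses k. ?b ^ m - 1)"
      using bound by (intro sum_mono) (simp add: le_diff_conv2)
    also have "\<dots> = card (responses k) * (?b ^ m - 1)" by simp
    also have "\<dots> \<le> ?b * (?b ^ m - 1)"
      by (intro mult_right_mono card_responses_le) simp
    also have "\<dots> = ?b ^ n - ?b"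
      by (simp only: Suc power_Suc diff_mult_distrib2 mult_1_right)
    finally have "2 * N \<le> ?b ^ n - ?b" .
    moreover have "?b \<le> ?b ^ n"
      using self_le_power[of ?b n] Suc by simp
    ultimately show ?thesis by linarith
  qed
qed


section \<open>Balanced digits\<close>

lemma residue_bounds: "0 \<le> x mod (2 * int k + 1)" "x mod (2 * int k + 1) < 2 * int k + 1"
  by (rule pos_mod_sign, simp) (rule pos_mod_bound, simp)

text \<open>The integer nearest to \<open>j / (2 * k + 1)\<close>. There are no ties as the divisor is odd, so, unlike the
  floor, this rounding commutes with negation. Iterating it strips the balanced digits, which lie
  between \<open>- k\<close> and \<open>k\<close>, off the integer \<open>j\<close>.\<close>

definition nearest_quotient :: "nat \<Rightarrow> int \<Rightarrow> int" where
  "nearest_quotient k j = (j + int k) div (2 * int k + 1)"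

lemma nearest_quotient_eqI:
  assumes "j = (2 * int k + 1) * q + d" "\<bar>d\<bar> \<le> int k"
  shows "nearest_quotient k j = q"
  unfolding nearest_quotient_def
  using assms by (intro int_div_pos_eq[where r = "d + int k"]) auto

lemma nearest_quotient_remainder:
  obtains d where "j = (2 * int k + 1) * nearest_quotient k j + d" "\<bar>d\<bar> \<le> int k"
proof
  let ?r = "(j + int k) mod (2 * int k + 1)"
  show "j = (2 * int k + 1) * nearest_quotient k j + (?r - int k)"
    using mult_div_mod_eq[of "2 * int k + 1" "j + int k"] unfolding nearest_quotient_def by linarith
  have "0 \<le> ?r" "?r < 2 * int k + 1" by (rule residue_bounds)+
  then show "\<bar>?r - int k\<bar> \<le> int k" by linarith
qed

lemma nearest_quotient_minus: "nearest_quotient k (- j) = - nearest_quotient k j"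
proof -
  obtain d where d: "j = (2 * int k + 1) * nearest_quotient k j + d" "\<bar>d\<bar> \<le> int k"
    by (rule nearest_quotient_remainder)
  show ?thesis
  proof (rule nearest_quotient_eqI)
    show "- j = (2 * int k + 1) * - nearest_quotient k j + - d"
      using d(1) by (simp only: mult_minus_right)
  qed (use d(2) in simp)
qed

lemma nearest_quotient_funpow_minus:
  "(nearest_quotient k ^^ i) (- j) = - (nearest_quotient k ^^ i) j"
  by (induction i) (simp_all add: nearest_quotient_minus)

text \<open>The residue of the \<open>i\<close>-th iterated quotient is the \<open>i\<close>-th balanced digit, and the size bound says
  that \<open>m\<close> digits suffice to write \<open>j\<close>.\<close>

lemma balanced_digits_inj:
  assumes "2 * \<bar>j\<bar> < (2 * int k + 1) ^ m" "2 * \<bar>j'\<bar> < (2 * int k + 1) ^ m"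
    and "\<And>i. i < m \<Longrightarrow>
      [(nearest_quotient k ^^ i) j = (nearest_quotient k ^^ i) j'] (mod 2 * int k + 1)"
  shows "j = j'"
  using assms
proof (induction m arbitrary: j j')
  case 0
  then show ?case by simp
next
  case (Suc m)
  let ?b = "2 * int k + 1"
  obtain d where d: "j = ?b * nearest_quotient k j + d" "\<bar>d\<bar> \<le> int k"
    by (rule nearest_quotient_remainder)
  obtain d' where d': "j' = ?b * nearest_quotient k j' + d'" "\<bar>d'\<bar> \<le> int k"
    by (rule nearest_quotient_remainder)
  have small: "2 * \<bar>q\<bar> < ?b ^ m" if "j0 = ?b * q + d0" "\<bar>d0\<bar> \<le> int k" "2 * \<bar>j0\<bar> < ?b ^ Suc m" for j0 q d0
  proof -
    have "?b * \<bar>q\<bar> = \<bar>?b * q\<bar>" by (simp add: abs_mult)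
    also have "\<dots> \<le> \<bar>j0\<bar> + int k" using that(1,2) by linarith
    finally have "?b * (2 * \<bar>q\<bar>) < ?b * (?b ^ m + 1)"
      using that(3) by (simp add: algebra_simps)
    then have "2 * \<bar>q\<bar> < ?b ^ m + 1"
      by (rule mult_left_less_imp_less) simp
    \<comment> \<open>Parity excludes the boundary value that rounding would still permit.\<close>
    moreover have "odd (?b ^ m)" by simp
    then have "2 * \<bar>q\<bar> \<noteq> ?b ^ m" by (metis dvd_triv_left)
    ultimately show ?thesis by linarith
  qed
  have "nearest_quotient k j = nearest_quotient k j'"
  proof (rule Suc.IH)
    show "2 * \<bar>nearest_quotient k j\<bar> < ?b ^ m" by (rule small[OF d Suc.prems(1)])
    show "2 * \<bar>nearest_quotient k j'\<bar> < ?b ^ m" by (rule small[OF d' Suc.prems(2)])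
    show "[(nearest_quotient k ^^ i) (nearest_quotient k j)
        = (nearest_quotient k ^^ i) (nearest_quotient k j')] (mod ?b)" if "i < m" for i
      using Suc.prems(3)[of "Suc i"] that by (simp add: funpow_swap1)
  qed
  moreover have "d = d'"
  proof -
    have "[j = j'] (mod ?b)" using Suc.prems(3)[of 0] by simp
    then have "?b dvd j - j'" by (simp add: cong_iff_dvd_diff)
    moreover have "j - j' = d - d'" using d(1) d'(1) calculation \<open>nearest_quotient k j = _\<close> by simp
    ultimately have "?b dvd d - d'" by simp
    then show ?thesis
      using d(2) d'(2) zdvd_imp_le[of ?b "\<bar>d - d'\<bar>"] by fastforce
  qed
  ultimately show ?case using d(1) d'(1) by simp
qed

section \<open>The weighing scheme\<close>

text \<open>Residue 0 leaves the coin aside. The residues \<open>s + 1\<close> and \<open>- (s + 1)\<close> are the left and the right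
  pan of scale \<open>s\<close>, so that negating a letter swaps pans.\<close>

definition place :: "nat \<Rightarrow> int \<Rightarrow> (nat \<times> side) option" where
  "place k x = (let v = nat (x mod (2 * int k + 1)) in
     if v = 0 then None
     else if v \<le> k then Some (v - 1, Left_Pan)
     else Some (2 * k - v, Right_Pan))"

lemma place_Some_iff:
  assumes "s < k"
  shows "place k x = Some (s, d) \<longleftrightarrow>
    x mod (2 * int k + 1) = (if d = Left_Pan then int s + 1 else 2 * int k - int s)"
proof -
  define v where "v = x mod (2 * int k + 1)"
  have "0 \<le> v" "v < 2 * int k + 1" unfolding v_def by (rule residue_bounds)+
  then show ?thesis using assms
    unfolding place_def v_def[symmetric] Let_def by (cases d) (auto simp: nat_le_iff)
qed

lemma place_scale: "place k x = Some (s, d) \<Longrightarrow> s < k"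
proof -
  define v where "v = x mod (2 * int k + 1)"
  have "0 \<le> v" "v < 2 * int k + 1" unfolding v_def by (rule residue_bounds)+
  then show "place k x = Some (s, d) \<Longrightarrow> s < k"
    unfolding place_def v_def[symmetric] Let_def by (auto split: if_splits)
qed

lemma place_eq_iff: "place k x = place k y \<longleftrightarrow> [x = y] (mod 2 * int k + 1)"
proof -
  define v where "v = x mod (2 * int k + 1)"
  define w where "w = y mod (2 * int k + 1)"
  have "0 \<le> v" "v < 2 * int k + 1" "0 \<le> w" "w < 2 * int k + 1"
    unfolding v_def w_def by (rule residue_bounds)+
  then show ?thesis
    unfolding place_def v_def[symmetric] w_def[symmetric] Let_def cong_def
    by (auto split: if_splits)
qed

lemma place_minus: "place k (- x) = map_option (apsnd opposite) (place k x)"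
proof -
  define v where "v = x mod (2 * int k + 1)"
  have "0 \<le> v" "v < 2 * int k + 1" unfolding v_def by (rule residue_bounds)+
  moreover have "(- x) mod (2 * int k + 1) = (if v = 0 then 0 else 2 * int k + 1 - v)"
    unfolding v_def by (simp add: zmod_zminus1_eq_if)
  ultimately show ?thesis
    unfolding place_def v_def[symmetric] Let_def
    by (auto simp: nat_diff_distrib' nat_le_iff)
qed

fun sign :: "label \<Rightarrow> int" where
  "sign Lighter = 1"
| "sign Heavier = -1"

text \<open>One minute reveals exactly the letter of the fake coin, up to the sign given by its label.\<close>

lemma response_place_eq_iff:
  "response (place k x) l = response (place k y) l' \<longleftrightarrow>
     [sign l * x = sign l' * y] (mod 2 * int k + 1)"
proof -
  have "response (place k x) l = response (place k (sign l * x)) Lighter" for x l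
    by (cases l) (simp_all add: response_Heavier place_minus)
  then show ?thesis
    by (metis place_eq_iff response_Lighter_inj)
qed

text \<open>Coin \<open>c\<close> has the word \<open>(t, t + q\<^sub>0, t + q\<^sub>1, \<dots>)\<close>, where \<open>t = c mod (2 * k + 1)\<close> is its
  place within the orbit and \<open>q\<^sub>i\<close> are the iterated quotients of the positive integer
  \<open>c div (2 * k + 1) + 1\<close> that names the orbit. Letters matter only modulo \<open>2 * k + 1\<close>.\<close>

definition word :: "nat \<Rightarrow> nat \<Rightarrow> nat \<Rightarrow> int" where
  "word k c i = int (c mod (2 * k + 1)) +
     (case i of 0 \<Rightarrow> 0 | Suc i' \<Rightarrow> (nearest_quotient k ^^ i') (int (c div (2 * k + 1)) + 1))"

text \<open>The \<open>b\<close> numbers with a given quotient by \<open>b\<close> form an orbit. At a given position its letters are all residues,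
  shifted by an amount \<open>w\<close> that depends on the orbit only, so that each residue occurs once per
  orbit.\<close>

lemma card_shifted_residue:
  fixes b a :: nat and w :: "nat \<Rightarrow> int"
  assumes v: "0 \<le> v" "v < int b"
  shows "card {c. c < b * a \<and> (int (c mod b) + w (c div b)) mod int b = v} = a"
proof -
  have b: "b > 0" using v by simp
  define t where "t j = nat ((v - w j) mod int b)" for j
  have t: "t j < b" for j using b by (simp add: t_def nat_less_iff)
  have key: "(int r + w j) mod int b = v \<longleftrightarrow> r = t j" if "r < b" for r j
  proof -
    have "(int r + w j) mod int b = v \<longleftrightarrow> [int r + w j = v] (mod int b)"
      using v by (simp add: cong_def)
    also have "\<dots> \<longleftrightarrow> [int r = v - w j] (mod int b)"
      by (simp add: cong_iff_dvd_diff algebra_simps)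
    also have "\<dots> \<longleftrightarrow> r = t j"
      using that b by (auto simp: cong_def t_def zmod_int)
    finally show ?thesis .
  qed
  let ?C = "{c. c < b * a \<and> (int (c mod b) + w (c div b)) mod int b = v}"
  have "bij_betw (\<lambda>j. b * j + t j) {..<a} ?C"
  proof (rule bij_betw_byWitness[where f' = "\<lambda>c. c div b"])
    show "(\<lambda>j. b * j + t j) ` {..<a} \<subseteq> ?C"
    proof (rule image_subsetI)
      fix j assume "j \<in> {..<a}"
      then have "b * Suc j \<le> b * a" by (intro mult_le_mono2) auto
      then have "b * j + t j < b * a" using t[of j] by simp
      then show "b * j + t j \<in> ?C"
        using t[of j] key[of "t j" j] b by simp
    qed
    show "(\<lambda>c. c div b) ` ?C \<subseteq> {..<a}"
      using b by (auto simp: less_mult_imp_div_less mult.commute)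
    show "\<forall>j\<in>{..<a}. (b * j + t j) div b = j" using t b by simp
    show "\<forall>c\<in>?C. b * (c div b) + t (c div b) = c"
    proof
      fix c assume "c \<in> ?C"
      then have "(int (c mod b) + w (c div b)) mod int b = v" by blast
      then have "t (c div b) = c mod b" using key[of "c mod b" "c div b"] b by simp
      then show "b * (c div b) + t (c div b) = c" by simp
    qed
  qed
  then show ?thesis by (simp add: bij_betw_same_card[symmetric])
qed

lemma valid_placement_word:
  "valid_placement k ((2 * k + 1) * a) (\<lambda>c. place k (word k c i))"
proof -
  let ?b = "2 * k + 1"
  have "card (pan (?b * a) (\<lambda>c. place k (word k c i)) s d) = a" if s: "s < k" for s d
  proof -
    let ?v = "if d = Left_Pan then int s + 1 else 2 * int k - int s"
    have "pan (?b * a) (\<lambda>c. place k (word k c i)) s d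
        = {c. c < ?b * a \<and> (int (c mod ?b) +
            (\<lambda>j. case i of 0 \<Rightarrow> 0 | Suc i' \<Rightarrow> (nearest_quotient k ^^ i') (int j + 1)) (c div ?b))
              mod int ?b = ?v}"
      unfolding pan_def place_Some_iff[OF s] word_def by (simp add: add.commute)
    also have "card \<dots> = a" by (rule card_shifted_residue) (use s in auto)
    finally show ?thesis .
  qed
  then show ?thesis by (auto simp: valid_placement_def dest: place_scale)
qed

text \<open>The first letter gives \<open>\<plusminus> t\<close>. Subtracting it from the others leaves the digits of the signed
  orbit number, and as orbit numbers are positive, this yields the sign and the orbit.\<close>

lemma signed_words_inj:
  assumes n: "2 * a < (2 * k + 1) ^ m"
    and c: "c < (2 * k + 1) * a" and c': "c' < (2 * k + 1) * a"
    and eq: "\<And>i. i < Suc m \<Longrightarrow>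
      [sign l * word k c i = sign l' * word k c' i] (mod 2 * int k + 1)"
  shows "c = c' \<and> l = l'"
proof -
  let ?b = "2 * k + 1"
  define t t' where "t = int (c mod ?b)" and "t' = int (c' mod ?b)"
  define j j' where "j = int (c div ?b) + 1" and "j' = int (c' div ?b) + 1"
  have first: "[sign l * t = sign l' * t'] (mod 2 * int k + 1)"
    using eq[of 0] by (simp add: word_def t_def t'_def)
  have sgn: "(nearest_quotient k ^^ i) (sign l * x) = sign l * (nearest_quotient k ^^ i) x" for i x l
    by (cases l) (simp_all add: nearest_quotient_funpow_minus)
  have bound: "2 * \<bar>sign l * (int (c div ?b) + 1)\<bar> < (2 * int k + 1) ^ m"
    if "c < ?b * a" for c l
  proof -
    have "c div ?b < a" using that by (simp add: less_mult_imp_div_less mult.commute)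
    then have "2 * (c div ?b + 1) \<le> 2 * a" by (intro mult_le_mono2) simp
    then have "2 * (c div ?b + 1) < ?b ^ m" using n by (rule le_less_trans)
    then have "int (2 * (c div ?b + 1)) < int (?b ^ m)" by (simp only: of_nat_less_iff)
    then show ?thesis by (cases l) (simp_all add: add.commute)
  qed
  have "sign l * j = sign l' * j'"
  proof (rule balanced_digits_inj)
    show "2 * \<bar>sign l * j\<bar> < (2 * int k + 1) ^ m" unfolding j_def by (rule bound[OF c])
    show "2 * \<bar>sign l' * j'\<bar> < (2 * int k + 1) ^ m" unfolding j'_def by (rule bound[OF c'])
    fix i assume "i < m"
    then have "[sign l * (t + (nearest_quotient k ^^ i) j) = sign l' * (t' + (nearest_quotient k ^^ i) j')]
        (mod 2 * int k + 1)"
      using eq[of "Suc i"] by (simp add: word_def t_def t'_def j_def j'_def)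
    from cong_diff[OF this first]
    show "[(nearest_quotient k ^^ i) (sign l * j) = (nearest_quotient k ^^ i) (sign l' * j')]
        (mod 2 * int k + 1)"
      unfolding sgn by (simp add: algebra_simps)
  qed
  moreover have "j > 0" "j' > 0" by (simp_all add: j_def j'_def)
  ultimately have l: "l = l'" and j: "j = j'" by (cases l; cases l'; simp)+
  have "[t = t'] (mod 2 * int k + 1)"
    using first unfolding l by (cases l') (simp_all add: cong_minus_minus_iff)
  moreover have "0 \<le> t" "t < 2 * int k + 1" "0 \<le> t'" "t' < 2 * int k + 1"
    using residue_bounds[of "int c" k] residue_bounds[of "int c'" k]
    by (simp_all add: t_def t'_def zmod_int add.commute)
  ultimately have "t = t'" by (simp add: cong_def)
  with j have "c div ?b = c' div ?b" "c mod ?b = c' mod ?b"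
    unfolding t_def t'_def j_def j'_def by simp_all
  then have "c = c'" by (metis mult_div_mod_eq)
  with l show ?thesis by simp
qed

lemma trace_nonadaptive:
  "trace (\<lambda>h. P (length h)) n (f, l) = map (\<lambda>i. response (P i f) l) [0..<n]"
  by (induction n) simp_all

lemma solvable_in_cyclic_scheme:
  assumes "2 * a < (2 * k + 1) ^ m"
  shows "solvable_in k ((2 * k + 1) * a) (Suc m)"
proof -
  define \<sigma> :: strategy where "\<sigma> h = (\<lambda>c. place k (word k c (length h)))" for h
  have "inj_on (trace \<sigma> (Suc m)) (hypotheses ((2 * k + 1) * a))"
  proof (rule inj_onI)
    fix h h'
    assume mem: "h \<in> hypotheses ((2 * k + 1) * a)" "h' \<in> hypotheses ((2 * k + 1) * a)"
      and eq': "trace \<sigma> (Suc m) h = trace \<sigma> (Suc m) h'"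
    obtain c l c' l' where h: "h = (c, l)" "h' = (c', l')" by (cases h; cases h')
    have eq: "trace \<sigma> (Suc m) (c, l) = trace \<sigma> (Suc m) (c', l')"
      using eq' unfolding h .
    have "[sign l * word k c i = sign l' * word k c' i] (mod 2 * int k + 1)" if "i < Suc m" for i
      using eq that unfolding \<sigma>_def trace_nonadaptive[where P = "\<lambda>i c. place k (word k c i)"]
      by (simp add: response_place_eq_iff[symmetric] del: upt_Suc)
    then have "c = c' \<and> l = l'"
      using mem h by (intro signed_words_inj[OF assms]) auto
    then show "h = h'" using h by simp
  qed
  moreover have "valid_placement k ((2 * k + 1) * a) (\<sigma> h)" for h
    unfolding \<sigma>_def by (rule valid_placement_word)
  ultimately show ?thesis
    unfolding solvable_in_iff_inj_trace by blast
qed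

section \<open>The maximum\<close>

text \<open>Coin 0 weighing 2 beside a genuine coin of weight 1 and coin 1 weighing 1 beside a genuine coin of
  weight 2 are the same physical situation, but require different verdicts.\<close>

lemma not_solvable_in_two: "\<not> solvable_in k 2 n"
proof
  assume "solvable_in k 2 n"
  then obtain \<sigma> verdict where
    ver: "\<And>f v g. f < 2 \<Longrightarrow> 0 < v \<Longrightarrow> 0 < g \<Longrightarrow> v \<noteq> g \<Longrightarrow>
      verdict (run 2 (coin_weight f v g) \<sigma> n) = (f, if v > g then Heavier else Lighter)"
    unfolding solvable_in_def by blast
  have "coin_weight 0 2 1 c = coin_weight 1 1 2 c" if "c \<in> pan 2 p s d" for p s d c
    using that by (auto simp: pan_def coin_weight_def less_2_cases_iff)
  then have "minute_result 2 (coin_weight 0 2 1) p = minute_result 2 (coin_weight 1 1 2) p" for p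
    by (simp add: minute_result_def fun_eq_iff cong: sum.cong)
  then have "run 2 (coin_weight 0 2 1) \<sigma> n = run 2 (coin_weight 1 1 2) \<sigma> n"
    by (induction n) simp_all
  then show False using ver[of 0 2 1] ver[of 1 1 2] by simp
qed

lemma coin_numbers_bound:
  assumes "N \<in> coin_numbers k n"
  shows "2 * N + (2 * k + 1) \<le> (2 * k + 1) ^ n"
  using assms solvable_in_imp_bound by (simp add: coin_numbers_def requires_minutes_def)

text \<open>The extremal number of coins can be handled in \<open>n\<close> minutes, and in no fewer because the upper bound
  is strictly increasing in the number of minutes.\<close>

lemma Max_coin_numbers:
  assumes "k \<ge> 1" "n \<ge> 2"
  shows "finite (coin_numbers k n)" "coin_numbers k n \<noteq> {}"
    "2 * Max (coin_numbers k n) + (2 * k + 1) = (2 * k + 1) ^ n"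
proof -
  let ?b = "2 * k + 1"
  obtain m where m: "n = Suc m" "m \<ge> 1" using assms(2) by (cases n) auto
  define a where "a = (?b ^ m - 1) div 2"
  define M where "M = ?b * a"
  have "odd (?b ^ m)" by simp
  then have a: "2 * a + 1 = ?b ^ m" unfolding a_def by (simp add: odd_pos)
  have M: "2 * M + ?b = ?b ^ n"
  proof -
    have "2 * M + ?b = ?b * (2 * a + 1)" unfolding M_def by (simp only: algebra_simps)
    then show ?thesis unfolding a by (simp add: m)
  qed
  have "?b \<le> ?b ^ m" using self_le_power[of ?b m] m by simp
  then have "a \<ge> 1" using a assms(1) by linarith
  then have "M \<ge> 1" unfolding M_def by simp
  have "\<not> solvable_in k M i" if "i < n" for i
  proof
    assume "solvable_in k M i"
    from solvable_in_imp_bound[OF this \<open>M \<ge> 1\<close>] have "?b ^ n \<le> ?b ^ i" unfolding M .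
    moreover have "?b ^ i < ?b ^ n" using that assms(1) by (intro power_strict_increasing) auto
    ultimately show False by simp
  qed
  moreover have "solvable_in k M n"
    unfolding M_def m using a by (intro solvable_in_cyclic_scheme) linarith
  ultimately have mem: "M \<in> coin_numbers k n"
    using \<open>M \<ge> 1\<close> by (simp add: coin_numbers_def requires_minutes_def)
  have le: "N \<le> M" if "N \<in> coin_numbers k n" for N
    using coin_numbers_bound[OF that] M by linarith
  show fin: "finite (coin_numbers k n)"
    using le by (intro finite_subset[OF _ finite_atMost[of M]]) auto
  show "coin_numbers k n \<noteq> {}" using mem by blast
  show "2 * Max (coin_numbers k n) + ?b = ?b ^ n"
    using Max_eqI[OF fin le mem] M by simp
qed

theorem theorem6:
  fixes k :: nat
  assumes "k \<ge> 1"
  shows "(\<forall>n\<ge>2. finite (coin_numbers k n) \<and> coin_numbers k n \<noteq> {} \<and>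
            real (Max (coin_numbers k n)) = ((2 * real k + 1) ^ n + 1) / 2 - real k - 1)
       \<and> (coin_numbers k 1 = {} \<and> ((2 * real k + 1) ^ 1 + 1) / 2 - real k - 1 = 0)
       \<and> \<not> (\<exists>n. solvable_in k 2 n)"
proof (intro conjI allI impI)
  fix n :: nat assume n: "n \<ge> 2"
  show "finite (coin_numbers k n)" "coin_numbers k n \<noteq> {}"
    using Max_coin_numbers[OF assms n] by blast+
  have "real (2 * Max (coin_numbers k n) + (2 * k + 1)) = real ((2 * k + 1) ^ n)"
    using Max_coin_numbers(3)[OF assms n] by (simp only:)
  then show "real (Max (coin_numbers k n)) = ((2 * real k + 1) ^ n + 1) / 2 - real k - 1"
    by (simp add: field_simps)
next
  have "N < 1" if "N \<in> coin_numbers k 1" for N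
    using coin_numbers_bound[OF that] by simp
  then show "coin_numbers k 1 = {}" by (fastforce simp: coin_numbers_def)
  show "((2 * real k + 1) ^ 1 + 1) / 2 - real k - 1 = 0" by (simp add: field_simps)
  show "\<not> (\<exists>n. solvable_in k 2 n)" using not_solvable_in_two by blast
qed

end
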